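(* (Conservative updating rule.) Let $\mathcal{C}$ be a finite non-empty set (of classes), let $n\ge 1$, let $\mathcal{A}_1,\dots,\mathcal{A}_n$ be finite non-empty sets, and put $\mathcal{X}=\mathcal{A}_1\times\cdots\times\mathcal{A}_n$. Let $P_0$ be a linear prevision on $\mathcal{L}(\mathcal{C}\times\mathcal{X})$. For each $k$ let $\mathcal{O}_k=\mathcal{A}_k\cup\{*\}$, where $*\notin\mathcal{A}_k$ is a new symbol meaning "missing", let $\mathcal{O}=\mathcal{O}_1\times\cdots\times\mathcal{O}_n$, and for $x=(a_1,\dots,a_n)\in\mathcal{X}$ let $\Gamma(x)=\{a_1,*\}\times\cdots\times\{a_n,*\}\subseteq\mathcal{O}$. For $o\in\mathcal{O}$ let $\{o\}^*=\{x\in\mathcal{X}:o\in\Gamma(x)\}$. The relationship between the attributes variable $X$ and the observations variable $O$ is modelled by the vacuous conditional lower prevision $\underline{P}(g|x)=\min_{o\in\Gamma(x)}g(o)$ for $g\in\mathcal{L}(\mathcal{O})$, $x\in\mathcal{X}$. Assume the irrelevance assumption: for all gambles $f$ on $\mathcal{C}$, $$\underline{P}(f|x,o)=P_0(f|x)\quad\text{for all }x\in\mathcal{X}\text{ and }o\in\Gamma(x).$$ Let $\underline{R}(\cdot|O)$ be the conditional lower prevision on $\mathcal{L}(\mathcal{C})$ obtained by regular extension from the resulting joint lower prevision on $\mathcal{L}(\mathcal{C}\times\mathcal{X}\times\mathcal{O})$ (defined in the context). Let $o$ be any element of $\mathcal{O}$. If $P_0(\{x\})>0$ for all $x\in\{o\}^*$,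 then $$\underline{R}(f|o)=\min_{x:\ o\in\Gamma(x)}P_0(f|x)\qquad\text{for all }f\in\mathcal{L}(\mathcal{C}).$$
   Context: Let $\mathcal{Z}$ be a finite non-empty set. A gamble on $\mathcal{Z}$ is a function $\mathcal{Z}\to\mathbb{R}$; $\mathcal{L}(\mathcal{Z})$ is the set of all gambles on $\mathcal{Z}$; $I_A$ is the indicator of $A\subseteq\mathcal{Z}$. A linear prevision $P$ on $\mathcal{L}(\mathcal{Z})$ is the expectation operator $P(f)=\sum_z f(z)p(z)$ of a probability mass function $p$ on $\mathcal{Z}$; $P(A)$ means $P(I_A)$. For a lower prevision $\underline{Q}:\mathcal{L}(\mathcal{Z})\to\mathbb{R}$, $\mathcal{M}(\underline{Q})$ is the set of linear previsions $P$ on $\mathcal{L}(\mathcal{Z})$ with $P(f)\ge\underline{Q}(f)$ for all $f$, and $\overline{Q}(f)=-\underline{Q}(-f)$. Let $p_0$ be the mass function of $P_0$ on $\mathcal{C}\times\mathcal{X}$. Write $p_0(x)=P_0(\{x\})=\sum_{c\in\mathcal{C}}p_0(c,x)$ and, when $p_0(x)>0$, $P_0(f|x)=\sum_{c\in\mathcal{C}}f(c)\,p_0(c,x)/p_0(x)$ for $f\in\mathcal{L}(\mathcal{C})$. Joint model: combining $P_0$, the vacuous conditional $\underline{P}(\cdot|X)$ and the irrelevance assumption yields the joint lower prevision $\underline{P}$ on $\mathcal{L}(\mathcal{C}\times\mathcal{X}\times\mathcal{O})$ given by $$\underline{P}(h)=\sum_{x\in\mathcal{X},\,p_0(x)>0}p_0(x)\min_{o\in\Gamma(x)}P_0\big(h(\cdot,x,o)\,\big|\,x\big),\qquad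 h\in\mathcal{L}(\mathcal{C}\times\mathcal{X}\times\mathcal{O}).$$ Regular extension: for $o\in\mathcal{O}$ let $B_o=\mathcal{C}\times\mathcal{X}\times\{o\}$. For $f\in\mathcal{L}(\mathcal{C})$, identified with the gamble $(c,x,o')\mapsto f(c)$: if $\overline{P}(B_o)=0$, then $\underline{R}(f|o)=\min_{c\in\mathcal{C}}f(c)$; if $\overline{P}(B_o)>0$, then $$\underline{R}(f|o)=\inf\left\{\frac{P(f\,I_{B_o})}{P(B_o)}:P\in\mathcal{M}(\underline{P}),\ P(B_o)>0\right\}.$$ *)

theory Defs
  imports "HOL-Probability.Probability_Mass_Function"
begin

text \<open>
  A gamble on a finite carrier \<open>Z\<close> is represented by a total function whose values outside \<open>Z\<close>
  are never used: every functional below reads its argument on the carrier only.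
\<close>

definition linear_previsions :: "'z set \<Rightarrow> (('z \<Rightarrow> real) \<Rightarrow> real) set" where
  "linear_previsions Z =
     {P. \<exists>p. set_pmf p \<subseteq> Z \<and> P = (\<lambda>f. \<Sum>z\<in>Z. f z * pmf p z)}"

definition credal_set :: "'z set \<Rightarrow> (('z \<Rightarrow> real) \<Rightarrow> real) \<Rightarrow> (('z \<Rightarrow> real) \<Rightarrow> real) set" where
  "credal_set Z Q = {P \<in> linear_previsions Z. \<forall>f. P f \<ge> Q f}"

definition upper_prevision :: "(('z \<Rightarrow> real) \<Rightarrow> real) \<Rightarrow> ('z \<Rightarrow> real) \<Rightarrow> real" where
  "upper_prevision Q f = - Q (\<lambda>z. - f z)"

definition mass :: "(('z \<Rightarrow> real) \<Rightarrow> real) \<Rightarrow> 'z \<Rightarrow> real" where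
  "mass P z = P (indicat_real {z})"

definition marginal_mass :: "'c set \<Rightarrow> (('c \<times> 'x \<Rightarrow> real) \<Rightarrow> real) \<Rightarrow> 'x \<Rightarrow> real" where
  "marginal_mass C P0 x = (\<Sum>c\<in>C. mass P0 (c, x))"

text \<open>Meaningful only where \<^term>\<open>marginal_mass C P0 x > 0\<close>.\<close>

definition cond_prevision ::
    "'c set \<Rightarrow> (('c \<times> 'x \<Rightarrow> real) \<Rightarrow> real) \<Rightarrow> ('c \<Rightarrow> real) \<Rightarrow> 'x \<Rightarrow> real" where
  "cond_prevision C P0 f x = (\<Sum>c\<in>C. f c * mass P0 (c, x) / marginal_mass C P0 x)"

text \<open>
  The attribute sets \<open>A 1, \<dots>, A n\<close> are subsets of one type, and tuples are functions on
  \<open>{1..n}\<close>. In an observation, \<^term>\<open>None\<close> is the symbol for a missing value.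
\<close>

definition attr_tuples :: "nat \<Rightarrow> (nat \<Rightarrow> 'a set) \<Rightarrow> (nat \<Rightarrow> 'a) set" where
  "attr_tuples n A = (\<Pi>\<^sub>E k\<in>{1..n}. A k)"

definition obs_tuples :: "nat \<Rightarrow> (nat \<Rightarrow> 'a set) \<Rightarrow> (nat \<Rightarrow> 'a option) set" where
  "obs_tuples n A = (\<Pi>\<^sub>E k\<in>{1..n}. insert None (Some ` A k))"

definition possible_obs :: "nat \<Rightarrow> (nat \<Rightarrow> 'a) \<Rightarrow> (nat \<Rightarrow> 'a option) set" where
  "possible_obs n x = (\<Pi>\<^sub>E k\<in>{1..n}. {Some (x k), None})"

definition completions ::
    "nat \<Rightarrow> (nat \<Rightarrow> 'a set) \<Rightarrow> (nat \<Rightarrow> 'a option) \<Rightarrow> (nat \<Rightarrow> 'a) set" where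
  "completions n A ob = {x \<in> attr_tuples n A. ob \<in> possible_obs n x}"

definition vacuous_cond ::
    "nat \<Rightarrow> ((nat \<Rightarrow> 'a option) \<Rightarrow> real) \<Rightarrow> (nat \<Rightarrow> 'a) \<Rightarrow> real" where
  "vacuous_cond n g x = Min (g ` possible_obs n x)"

text \<open>
  \<open>PXO f x ob\<close> stands for the lower prevision of the class gamble \<open>f\<close> conditional on the
  attributes \<open>x\<close> and the observation \<open>ob\<close>. As \<^const>\<open>cond_prevision\<close> has no meaning where the
  marginal mass of \<open>x\<close> is zero, nothing is required there.
\<close>

definition irrelevance ::
    "'c set \<Rightarrow> nat \<Rightarrow> (nat \<Rightarrow> 'a set) \<Rightarrow> (('c \<times> (nat \<Rightarrow> 'a) \<Rightarrow> real) \<Rightarrow> real) \<Rightarrow>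
     (('c \<Rightarrow> real) \<Rightarrow> (nat \<Rightarrow> 'a) \<Rightarrow> (nat \<Rightarrow> 'a option) \<Rightarrow> real) \<Rightarrow> bool" where
  "irrelevance C n A P0 PXO \<longleftrightarrow>
     (\<forall>f. \<forall>x\<in>attr_tuples n A. marginal_mass C P0 x > 0 \<longrightarrow>
        (\<forall>ob\<in>possible_obs n x. PXO f x ob = cond_prevision C P0 f x))"

text \<open>
  Marginal extension: condition first on attributes and observation, then (vacuously) on the
  attributes, and take the expectation over the attributes. The lemma below gives the form this
  takes under irrelevance.
\<close>

definition joint_lower ::
    "'c set \<Rightarrow> nat \<Rightarrow> (nat \<Rightarrow> 'a set) \<Rightarrow> (('c \<times> (nat \<Rightarrow> 'a) \<Rightarrow> real) \<Rightarrow> real) \<Rightarrow>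
     (('c \<Rightarrow> real) \<Rightarrow> (nat \<Rightarrow> 'a) \<Rightarrow> (nat \<Rightarrow> 'a option) \<Rightarrow> real) \<Rightarrow>
     ('c \<times> (nat \<Rightarrow> 'a) \<times> (nat \<Rightarrow> 'a option) \<Rightarrow> real) \<Rightarrow> real" where
  "joint_lower C n A P0 PXO h =
     (\<Sum>x\<in>{x \<in> attr_tuples n A. marginal_mass C P0 x > 0}.
        marginal_mass C P0 x * vacuous_cond n (\<lambda>ob. PXO (\<lambda>c. h (c, x, ob)) x ob) x)"

lemma joint_lower_irrelevance:
  assumes "irrelevance C n A P0 PXO"
  shows "joint_lower C n A P0 PXO h =
     (\<Sum>x\<in>{x \<in> attr_tuples n A. marginal_mass C P0 x > 0}.
        marginal_mass C P0 x *
          (MIN ob\<in>possible_obs n x. cond_prevision C P0 (\<lambda>c. h (c, x, ob)) x))"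
  using assms unfolding joint_lower_def vacuous_cond_def irrelevance_def
  by (intro sum.cong refl arg_cong2[where f = "(*)"] arg_cong[where f = Min] image_cong) auto

definition obs_event ::
    "'c set \<Rightarrow> 'x set \<Rightarrow> 'y \<Rightarrow> ('c \<times> 'x \<times> 'y) set" where
  "obs_event C X ob = C \<times> X \<times> {ob}"

definition regular_extension ::
    "'c set \<Rightarrow> 'x set \<Rightarrow> 'y set \<Rightarrow> (('c \<times> 'x \<times> 'y \<Rightarrow> real) \<Rightarrow> real) \<Rightarrow>
     ('c \<Rightarrow> real) \<Rightarrow> 'y \<Rightarrow> real" where
  "regular_extension C X Y Q f ob =
     (let B = obs_event C X ob in
      if upper_prevision Q (indicat_real B) = 0 then Min (f ` C)
      else Inf {P (\<lambda>(c, x, y). f c * indicat_real B (c, x, y)) / P (indicat_real B) | P.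
                  P \<in> credal_set (C \<times> X \<times> Y) Q \<and> P (indicat_real B) > 0})"

end

theory Submission
  imports Defs
begin

text \<open>
  For the lower bound, put \<open>m = (MIN x. P\<^sub>0(f|x))\<close>: the joint lower prevision of \<open>(f - m) I\<^sub>B\<close> is
  nonnegative, so every dominating \<open>P\<close> has \<open>P(f I\<^sub>B) \<ge> m P(B)\<close>. For attainment, let \<open>x\<^sub>0\<close> be a
  minimising completion and let \<open>P\<close> be the law obtained from \<open>P\<^sub>0\<close> by the deterministic
  incompleteness mechanism that reports \<open>ob\<close> for \<open>x\<^sub>0\<close> and the complete observation of \<open>x\<close> for every
  other \<open>x\<close>. The complete observation of \<open>x\<close> has \<open>x\<close> as its only completion, so \<open>ob\<close> is reported
  exactly when \<open>X = x\<^sub>0\<close>, and conditioning \<open>P\<close> on \<open>ob\<close> gives \<open>P\<^sub>0(f|x\<^sub>0)\<close>.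
\<close>

section \<open>Mass functions, conditioning and push-forward of linear previsions\<close>

lemma linear_previsionsE:
  assumes "P \<in> linear_previsions Z"
  obtains p where "set_pmf p \<subseteq> Z" and "P = (\<lambda>f. \<Sum>z\<in>Z. f z * pmf p z)"
  using assms by (auto simp: linear_previsions_def)

lemma mass_sum_pmf:
  assumes "finite Z" and "z \<in> Z"
  shows "mass (\<lambda>f. \<Sum>z\<in>Z. f z * pmf p z) z = pmf p z"
proof -
  have "(\<Sum>y\<in>Z. indicat_real {z} y * pmf p y) = (\<Sum>y\<in>Z. if y = z then pmf p z else 0)"
    by (intro sum.cong) auto
  then show ?thesis
    using assms by (simp add: mass_def)
qed

lemma mass_nonneg:
  assumes "P \<in> linear_previsions Z"
  shows "mass P z \<ge> 0"
  using assms by (auto simp: linear_previsions_def mass_def intro!: sum_nonneg)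

lemma marginal_mass_nonneg:
  assumes "P0 \<in> linear_previsions Z"
  shows "marginal_mass C P0 x \<ge> 0"
  unfolding marginal_mass_def using mass_nonneg[OF assms] by (simp add: sum_nonneg)

text \<open>Clearing the denominator is safe even where the marginal vanishes: nonnegative masses
  with sum 0 are all 0, so both sides are 0.\<close>

lemma marginal_mass_times_cond_prevision:
  assumes "finite C" and "P0 \<in> linear_previsions Z"
  shows "marginal_mass C P0 x * cond_prevision C P0 f x = (\<Sum>c\<in>C. f c * mass P0 (c, x))"
proof (cases "marginal_mass C P0 x = 0")
  case True
  then have "\<forall>c\<in>C. mass P0 (c, x) = 0"
    unfolding marginal_mass_def
    using assms(1) mass_nonneg[OF assms(2)] by (subst (asm) sum_nonneg_eq_0_iff) auto
  then show ?thesis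
    using True by simp
next
  case False
  then show ?thesis
    by (simp add: cond_prevision_def sum_distrib_left)
qed

text \<open>The conditional masses sum to 1. At marginal 0, division by zero would instead give 0 on
  the left and \<open>-m\<close> on the right.\<close>

lemma cond_prevision_diff_const:
  assumes "marginal_mass C P0 x > 0"
  shows "cond_prevision C P0 (\<lambda>c. f c - m) x = cond_prevision C P0 f x - m"
proof -
  have "(\<Sum>c\<in>C. mass P0 (c, x) / marginal_mass C P0 x) = 1"
    using assms by (simp add: sum_divide_distrib[symmetric] marginal_mass_def)
  then have "(\<Sum>c\<in>C. m * mass P0 (c, x) / marginal_mass C P0 x) = m"
    by (simp flip: sum_distrib_left times_divide_eq_right)
  then show ?thesis
    by (simp add: cond_prevision_def left_diff_distrib diff_divide_distrib sum_subtractf)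
qed

text \<open>This functional is the expectation under the push-forward of the mass function of
  \<open>P0\<close> along \<open>(c, x) \<mapsto> (c, x, g x)\<close>: the joint law when
  \<open>x\<close> is always reported as \<open>g x\<close>.\<close>

lemma mechanism_in_linear_previsions:
  assumes fin: "finite C" "finite X" "finite Y"
    and P0: "P0 \<in> linear_previsions (C \<times> X)"
    and g: "\<And>x. x \<in> X \<Longrightarrow> g x \<in> Y"
  shows "(\<lambda>h. \<Sum>x\<in>X. \<Sum>c\<in>C. h (c, x, g x) * mass P0 (c, x)) \<in> linear_previsions (C \<times> X \<times> Y)"
proof -
  from P0 obtain p where p: "set_pmf p \<subseteq> C \<times> X"
    and P0_eq: "P0 = (\<lambda>f. \<Sum>z\<in>C \<times> X. f z * pmf p z)"
    by (rule linear_previsionsE)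
  define q where "q = map_pmf (\<lambda>(c, x). (c, x, g x)) p"
  have q: "set_pmf q \<subseteq> C \<times> X \<times> Y"
    using p g by (auto simp: q_def)
  have "(\<Sum>x\<in>X. \<Sum>c\<in>C. h (c, x, g x) * mass P0 (c, x)) = (\<Sum>z\<in>C \<times> X \<times> Y. h z * pmf q z)"
    for h :: "'a \<times> 'b \<times> 'c \<Rightarrow> real"
  proof -
    have "(\<Sum>z\<in>C \<times> X \<times> Y. h z * pmf q z) = measure_pmf.expectation q h"
      using fin q by (intro integral_measure_pmf_real[symmetric]) auto
    also have "\<dots> = measure_pmf.expectation p (\<lambda>(c, x). h (c, x, g x))"
      by (simp add: q_def case_prod_unfold)
    also have "\<dots> = (\<Sum>z\<in>C \<times> X. (case z of (c, x) \<Rightarrow> h (c, x, g x)) * pmf p z)"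
      using fin p by (intro integral_measure_pmf_real) auto
    also have "\<dots> = (\<Sum>c\<in>C. \<Sum>x\<in>X. h (c, x, g x) * pmf p (c, x))"
      by (simp add: sum.cartesian_product case_prod_unfold)
    also have "\<dots> = (\<Sum>c\<in>C. \<Sum>x\<in>X. h (c, x, g x) * mass P0 (c, x))"
      unfolding P0_eq using fin by (intro sum.cong refl) (subst mass_sum_pmf, auto)
    finally show ?thesis
      by (subst sum.swap) simp
  qed
  then show ?thesis
    using q unfolding linear_previsions_def by blast
qed

section \<open>Observations and their completions\<close>

lemma finite_possible_obs: "finite (possible_obs n x)"
  unfolding possible_obs_def by (intro finite_PiE) auto

lemma possible_obs_nonempty: "possible_obs n x \<noteq> {}"
  by (simp add: possible_obs_def PiE_eq_empty_iff)

lemma possible_obs_subset_obs_tuples: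
  assumes "x \<in> attr_tuples n A"
  shows "possible_obs n x \<subseteq> obs_tuples n A"
  using assms unfolding possible_obs_def obs_tuples_def attr_tuples_def
  by (intro PiE_mono) auto

lemma complete_obs_in_possible_obs: "(\<lambda>k\<in>{1..n}. Some (x k)) \<in> possible_obs n x"
  by (auto simp: possible_obs_def)

text \<open>No entry of a complete observation is \<open>None\<close>, so each coordinate must agree
  with that of \<open>y\<close>.\<close>

lemma complete_obs_unique_completion:
  assumes "x \<in> attr_tuples n A" and "y \<in> attr_tuples n A"
    and "(\<lambda>k\<in>{1..n}. Some (x k)) \<in> possible_obs n y"
  shows "x = y"
proof (rule PiE_ext)
  show "x \<in> Pi\<^sub>E {1..n} A" "y \<in> Pi\<^sub>E {1..n} A"
    using assms(1,2) by (simp_all add: attr_tuples_def)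
  fix k assume k: "k \<in> {1..n}"
  from PiE_mem[OF assms(3)[unfolded possible_obs_def] k] show "x k = y k"
    using k by simp
qed

text \<open>Keep the observed coordinates and fill each missing one with any element of
  \<open>A k\<close>. This ensures that the minimum over completions is attained.\<close>

lemma completions_nonempty:
  assumes A: "\<And>k. k \<in> {1..n} \<Longrightarrow> A k \<noteq> {}" and ob: "ob \<in> obs_tuples n A"
  shows "completions n A ob \<noteq> {}"
proof -
  have "\<exists>a. a \<in> A k \<and> ob k \<in> {Some a, None}" if "k \<in> {1..n}" for k
    using A[OF that] PiE_mem[OF ob[unfolded obs_tuples_def] that] by auto
  then obtain x where x: "\<And>k. k \<in> {1..n} \<Longrightarrow> x k \<in> A k \<and> ob k \<in> {Some (x k), None}"
    by metis
  have "restrict x {1..n} \<in> completions n A ob"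
    using x ob by (auto simp: completions_def attr_tuples_def possible_obs_def obs_tuples_def PiE_iff)
  then show ?thesis
    by blast
qed

section \<open>The joint lower prevision and its regular extension\<close>

text \<open>For each \<open>x\<close> the joint lower prevision takes the least value over
  \<open>possible_obs n x\<close>; fixing the observation \<open>g x\<close> can only give
  more.\<close>

lemma mechanism_in_credal_set:
  assumes fin: "finite C" "finite (attr_tuples n A)" "finite (obs_tuples n A)"
    and P0: "P0 \<in> linear_previsions (C \<times> attr_tuples n A)"
    and irr: "irrelevance C n A P0 PXO"
    and g: "\<And>x. x \<in> attr_tuples n A \<Longrightarrow> g x \<in> possible_obs n x"
  shows "(\<lambda>h. \<Sum>x\<in>attr_tuples n A. \<Sum>c\<in>C. h (c, x, g x) * mass P0 (c, x))
    \<in> credal_set (C \<times> attr_tuples n A \<times> obs_tuples n A) (joint_lower C n A P0 PXO)"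
proof -
  let ?X = "attr_tuples n A" and ?mm = "marginal_mass C P0" and ?cond = "cond_prevision C P0"
  have "joint_lower C n A P0 PXO h \<le> (\<Sum>x\<in>?X. \<Sum>c\<in>C. h (c, x, g x) * mass P0 (c, x))" for h
  proof -
    have "joint_lower C n A P0 PXO h
        \<le> (\<Sum>x\<in>{x \<in> ?X. ?mm x > 0}. ?mm x * ?cond (\<lambda>c. h (c, x, g x)) x)"
      unfolding joint_lower_irrelevance[OF irr]
      using g by (intro sum_mono mult_left_mono) (auto simp: finite_possible_obs)
    \<comment> \<open>The added terms have marginal mass 0 and vanish.\<close>
    also have "\<dots> = (\<Sum>x\<in>?X. ?mm x * ?cond (\<lambda>c. h (c, x, g x)) x)"
      using fin marginal_mass_nonneg[OF P0, of C]
      by (intro sum.mono_neutral_left) (auto simp: order.order_iff_strict)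
    finally show ?thesis
      by (simp add: marginal_mass_times_cond_prevision[OF fin(1) P0])
  qed
  moreover have "(\<lambda>h. \<Sum>x\<in>?X. \<Sum>c\<in>C. h (c, x, g x) * mass P0 (c, x))
      \<in> linear_previsions (C \<times> ?X \<times> obs_tuples n A)"
    using g possible_obs_subset_obs_tuples
    by (intro mechanism_in_linear_previsions fin P0) blast
  ultimately show ?thesis
    by (simp add: credal_set_def)
qed

text \<open>In the minimum over \<open>y \<in> possible_obs n x\<close>, every
  \<open>y \<noteq> ob\<close> contributes 0. The value \<open>y = ob\<close> occurs only if
  \<open>x\<close> is a completion, and then contributes
  \<open>cond_prevision C P0 f x - m\<close>.\<close>

lemma joint_lower_event_nonneg:
  assumes irr: "irrelevance C n A P0 PXO"
    and m: "\<And>x. x \<in> completions n A ob \<Longrightarrow> m \<le> cond_prevision C P0 f x"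
  shows "joint_lower C n A P0 PXO
    (\<lambda>(c, x, y). (f c - m) * indicat_real (obs_event C (attr_tuples n A) ob) (c, x, y)) \<ge> 0"
  unfolding joint_lower_irrelevance[OF irr]
proof (intro sum_nonneg mult_nonneg_nonneg)
  fix x assume x: "x \<in> {x \<in> attr_tuples n A. marginal_mass C P0 x > 0}"
  then show "0 \<le> marginal_mass C P0 x"
    by simp
  let ?h = "\<lambda>y c. (f c - m) * indicat_real (obs_event C (attr_tuples n A) ob) (c, x, y)"
  have "0 \<le> cond_prevision C P0 (?h y) x" if "y \<in> possible_obs n x" for y
  proof (cases "y = ob")
    case True
    have "cond_prevision C P0 (?h y) x = cond_prevision C P0 (\<lambda>c. f c - m) x"
      using x True by (auto simp: cond_prevision_def obs_event_def intro!: sum.cong)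
    then show ?thesis
      using m[of x] x that True by (simp add: cond_prevision_diff_const completions_def)
  next
    case False
    then show ?thesis
      by (simp add: cond_prevision_def obs_event_def)
  qed
  then show "0 \<le> (MIN y\<in>possible_obs n x. cond_prevision C P0
      (\<lambda>c. case (c, x, y) of (c, x, y) \<Rightarrow>
        (f c - m) * indicat_real (obs_event C (attr_tuples n A) ob) (c, x, y)) x)"
    by (simp add: finite_possible_obs possible_obs_nonempty)
qed

text \<open>Reduces the infimum to one witness: \<open>nonneg\<close> makes \<open>m\<close> a lower
  bound of the ratio over the whole credal set, and \<open>P\<close> attains it.\<close>

lemma regular_extension_eqI:
  assumes P: "P \<in> credal_set (C \<times> X \<times> Y) Q" "P (indicat_real (obs_event C X ob)) > 0"
    and attained: "P (\<lambda>(c, x, y). f c * indicat_real (obs_event C X ob) (c, x, y))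
      = m * P (indicat_real (obs_event C X ob))"
    and nonneg: "Q (\<lambda>(c, x, y). (f c - m) * indicat_real (obs_event C X ob) (c, x, y)) \<ge> 0"
  shows "regular_extension C X Y Q f ob = m"
proof -
  let ?B = "indicat_real (obs_event C X ob)"
  let ?fB = "\<lambda>(c, x, y). f c * ?B (c, x, y)"
  \<comment> \<open>The witness also excludes the vacuous branch: \<open>Q\<close> of the negated
    indicator is at most \<open>- P ?B < 0\<close>, so the upper prevision of the event is
    positive.\<close>
  have "P (\<lambda>z. - ?B z) = - P ?B"
    using P(1) by (auto simp: credal_set_def linear_previsions_def sum_negf)
  moreover have "Q (\<lambda>z. - ?B z) \<le> P (\<lambda>z. - ?B z)"
    using P(1) by (simp add: credal_set_def)
  ultimately have upper: "upper_prevision Q ?B \<noteq> 0"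
    using P(2) by (simp add: upper_prevision_def)
  have "m \<le> P' ?fB / P' ?B" if P': "P' \<in> credal_set (C \<times> X \<times> Y) Q" "P' ?B > 0" for P'
  proof -
    have "0 \<le> P' (\<lambda>(c, x, y). (f c - m) * ?B (c, x, y))"
      using nonneg P'(1) by (force simp: credal_set_def intro: order_trans)
    also have "\<dots> = P' ?fB - m * P' ?B"
      using P'(1)
      by (auto simp: credal_set_def linear_previsions_def case_prod_unfold sum_distrib_left
          left_diff_distrib mult.assoc sum_subtractf)
    finally show ?thesis
      using P'(2) by (simp add: field_simps)
  qed
  moreover have "m = P ?fB / P ?B"
    using attained P(2) by simp
  ultimately have "Inf {P ?fB / P ?B | P. P \<in> credal_set (C \<times> X \<times> Y) Q \<and> P ?B > 0} = m"
    using P by (intro cInf_eq_minimum) blast+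
  then show ?thesis
    using upper by (simp add: regular_extension_def)
qed

theorem theorem2:
  fixes C :: "'c set" and n :: nat and A :: "nat \<Rightarrow> 'a set"
    and P0 :: "('c \<times> (nat \<Rightarrow> 'a) \<Rightarrow> real) \<Rightarrow> real"
    and PXO :: "('c \<Rightarrow> real) \<Rightarrow> (nat \<Rightarrow> 'a) \<Rightarrow> (nat \<Rightarrow> 'a option) \<Rightarrow> real"
    and ob :: "nat \<Rightarrow> 'a option"
  assumes "finite C" and "C \<noteq> {}"
    and "n \<ge> 1"
    and "\<And>k. k \<in> {1..n} \<Longrightarrow> finite (A k)" and "\<And>k. k \<in> {1..n} \<Longrightarrow> A k \<noteq> {}"
    and "P0 \<in> linear_previsions (C \<times> attr_tuples n A)"
    and "irrelevance C n A P0 PXO"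
    and "ob \<in> obs_tuples n A"
    and "\<And>x. x \<in> completions n A ob \<Longrightarrow> marginal_mass C P0 x > 0"
  shows "\<forall>f :: 'c \<Rightarrow> real.
    regular_extension C (attr_tuples n A) (obs_tuples n A) (joint_lower C n A P0 PXO) f ob =
      (MIN x\<in>completions n A ob. cond_prevision C P0 f x)"
proof
  fix f :: "'c \<Rightarrow> real"
  let ?X = "attr_tuples n A" and ?Y = "obs_tuples n A" and ?K = "completions n A ob"
  let ?cond = "cond_prevision C P0 f" and ?B = "indicat_real (obs_event C (attr_tuples n A) ob)"
  have fin: "finite C" "finite ?X" "finite ?Y"
    using assms(1,4) unfolding attr_tuples_def obs_tuples_def by (auto intro!: finite_PiE)
  have K: "finite ?K" "?K \<noteq> {}"
    using fin completions_nonempty[OF assms(5,8)] by (auto simp: completions_def)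
  then have "Min (?cond ` ?K) \<in> ?cond ` ?K"
    by (intro Min_in) auto
  then obtain x0 where x0: "x0 \<in> ?K" and min: "Min (?cond ` ?K) = ?cond x0"
    by blast
  define g where "g x = (if x = x0 then ob else (\<lambda>k\<in>{1..n}. Some (x k)))" for x
  have g: "g x \<in> possible_obs n x" for x
    using x0 complete_obs_in_possible_obs by (auto simp: g_def completions_def)
  \<comment> \<open>If \<open>g x = ob\<close> with \<open>x \<noteq> x0\<close>, the complete
    observation of \<open>x\<close> would lie in \<open>possible_obs n x0\<close>, forcing
    \<open>x = x0\<close>.\<close>
  have g_eq_ob: "g x = ob \<longleftrightarrow> x = x0" if "x \<in> ?X" for x
    using that x0 complete_obs_unique_completion[of x n A x0]
    by (auto simp: g_def completions_def)
  define P where "P h = (\<Sum>x\<in>?X. \<Sum>c\<in>C. h (c, x, g x) * mass P0 (c, x))"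
    for h :: "'c \<times> (nat \<Rightarrow> 'a) \<times> (nat \<Rightarrow> 'a option) \<Rightarrow> real"
  \<comment> \<open>A general \<open>k\<close> serves both parts of the ratio: \<open>k = f\<close>
    gives the numerator and \<open>k = 1\<close> the denominator.\<close>
  have P_event: "P (\<lambda>(c, x, y). k c * ?B (c, x, y)) = (\<Sum>c\<in>C. k c * mass P0 (c, x0))" for k
  proof -
    have "P (\<lambda>(c, x, y). k c * ?B (c, x, y))
        = (\<Sum>x\<in>?X. if x = x0 then \<Sum>c\<in>C. k c * mass P0 (c, x0) else 0)"
      unfolding P_def using g_eq_ob by (intro sum.cong) (auto simp: obs_event_def)
    then show ?thesis
      using fin x0 by (simp add: completions_def)
  qed
  have P_B: "P ?B = marginal_mass C P0 x0"
    using P_event[of "\<lambda>_. 1"] by (simp add: marginal_mass_def)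
  have "regular_extension C ?X ?Y (joint_lower C n A P0 PXO) f ob = ?cond x0"
  proof (rule regular_extension_eqI)
    show "P \<in> credal_set (C \<times> ?X \<times> ?Y) (joint_lower C n A P0 PXO)"
      unfolding P_def by (intro mechanism_in_credal_set fin assms g)
    show "P ?B > 0"
      using P_B assms(9)[OF x0] by simp
    show "P (\<lambda>(c, x, y). f c * ?B (c, x, y)) = ?cond x0 * P ?B"
      using marginal_mass_times_cond_prevision[OF assms(1,6), of x0 f]
      by (simp add: P_event P_B mult.commute)
    \<comment> \<open>Here the choice of \<open>x0\<close> as a minimiser enters: reading
      \<open>?cond x0\<close> as the minimum bounds it by the value at every completion.\<close>
    show "joint_lower C n A P0 PXO (\<lambda>(c, x, y). (f c - ?cond x0) * ?B (c, x, y)) \<ge> 0"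
      using K by (intro joint_lower_event_nonneg assms) (simp flip: min)
  qed
  then show "regular_extension C ?X ?Y (joint_lower C n A P0 PXO) f ob = (MIN x\<in>?K. ?cond x)"
    by (simp add: min)
qed

end
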